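(* The following hold for the Cantor fan $C$. 1. There is a continuous mapping $f:C\to C$ that is not a homeomorphism such that $(C,f)$ is chaotic in the sense of Robinson but not in the sense of Devaney. 2. There is a homeomorphism $h:C\to C$ such that $(C,h)$ is chaotic in the sense of Robinson but not in the sense of Devaney.
   Context: A Cantor fan is any continuum (non-empty compact connected metric space) homeomorphic to $\bigcup_{c\in K}A_c$, where $K\subseteq[0,1]$ is a Cantor set and, for each $c\in K$, $A_c$ is the convex segment in the plane from $(0,0)$ to $(c,-1)$; it is unique up to homeomorphism. A dynamical system is a pair $(X,f)$ where $(X,d)$ is a compact metric space and $f:X\to X$ is continuous. $(X,f)$ is transitive if for all non-empty open $U,V\subseteq X$ there is a non-negative integer $n$ with $f^n(U)\cap V\ne\emptyset$. $(X,f)$ has sensitive dependence on initial conditions if there is $\varepsilon>0$ such that for each $x\in X$ and each $\delta>0$ there are $y\in X$ with $d(x,y)<\delta$ and a positive integer $n$ with $d(f^n(x),f^n(y))>\varepsilon$ (for compact $X$ this does not depend on the choice of compatible metric). $\mathcal P(f)$ denotes the set of periodic points, i.e. points $p$ with $f^n(p)=p$ for some positive integer $n$. $(X,f)$ is chaotic in the sense of Robinson if it is transitive and has sensitive dependence on initial conditions. $(X,f)$ is chaotic in the sense of Devaney if it is transitive and $\mathcal P(f)$ is dense in $X$. *)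

theory Defs
  imports "HOL-Analysis.Analysis"
begin

text \<open>Spaces are subsets of a metric type, with the induced metric and the subspace topology.\<close>

definition continuum :: "'a::metric_space set \<Rightarrow> bool" where
  "continuum X \<longleftrightarrow> X \<noteq> {} \<and> compact X \<and> connected X"

text \<open>The middle-thirds Cantor set: the reals in \<open>[0,1]\<close> that have a ternary expansion
  using only the digits 0 and 2.\<close>

definition ternary_cantor_set :: "real set" where
  "ternary_cantor_set = range (\<lambda>a :: nat \<Rightarrow> bool. \<Sum>n. (if a n then 2 else 0) / 3 ^ Suc n)"

definition cantor_set :: "'a::metric_space set \<Rightarrow> bool" where
  "cantor_set K \<longleftrightarrow> K homeomorphic ternary_cantor_set"

definition planar_fan :: "real set \<Rightarrow> (real \<times> real) set" where
  "planar_fan K = (\<Union>c\<in>K. closed_segment (0, 0) (c, -1))"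

definition cantor_fan :: "'a::metric_space set \<Rightarrow> bool" where
  "cantor_fan C \<longleftrightarrow>
     continuum C \<and> (\<exists>K \<subseteq> {0..1}. cantor_set K \<and> C homeomorphic planar_fan K)"

text \<open>The notions below are meant for a compact \<open>X\<close> and a continuous \<open>f\<close> mapping \<open>X\<close> into itself;
  values of \<open>f\<close> outside \<open>X\<close> are then irrelevant.\<close>

definition dynamical_system :: "'a::metric_space set \<Rightarrow> ('a \<Rightarrow> 'a) \<Rightarrow> bool" where
  "dynamical_system X f \<longleftrightarrow> compact X \<and> continuous_on X f \<and> f ` X \<subseteq> X"

definition transitive_system :: "'a::metric_space set \<Rightarrow> ('a \<Rightarrow> 'a) \<Rightarrow> bool" where
  "transitive_system X f \<longleftrightarrow>
     (\<forall>U V. openin (top_of_set X) U \<and> U \<noteq> {} \<and> openin (top_of_set X) V \<and> V \<noteq> {} \<longrightarrow>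
        (\<exists>n::nat. (f ^^ n) ` U \<inter> V \<noteq> {}))"

definition sensitive_system :: "'a::metric_space set \<Rightarrow> ('a \<Rightarrow> 'a) \<Rightarrow> bool" where
  "sensitive_system X f \<longleftrightarrow>
     (\<exists>\<epsilon>>0. \<forall>x\<in>X. \<forall>\<delta>>0. \<exists>y\<in>X. dist x y < \<delta> \<and>
        (\<exists>n::nat. n > 0 \<and> dist ((f ^^ n) x) ((f ^^ n) y) > \<epsilon>))"

definition periodic_points :: "'a set \<Rightarrow> ('a \<Rightarrow> 'a) \<Rightarrow> 'a set" where
  "periodic_points X f = {p \<in> X. \<exists>n::nat. n > 0 \<and> (f ^^ n) p = p}"

definition robinson_chaotic :: "'a::metric_space set \<Rightarrow> ('a \<Rightarrow> 'a) \<Rightarrow> bool" where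
  "robinson_chaotic X f \<longleftrightarrow> transitive_system X f \<and> sensitive_system X f"

definition devaney_chaotic :: "'a::metric_space set \<Rightarrow> ('a \<Rightarrow> 'a) \<Rightarrow> bool" where
  "devaney_chaotic X f \<longleftrightarrow> transitive_system X f \<and> X \<subseteq> closure (periodic_points X f)"

end

theory Submission
  imports Defs
begin

text \<open>A Cantor fan is the cone over a space of 0-1 sequences: the product of the sequence space with
  \<open>[0,1]\<close>, with the level \<open>0\<close> collapsed to the apex. Both maps are skew products
  \<open>(a, t) \<mapsto> (\<sigma> a, t\<^sup>e)\<close> over a shift \<open>\<sigma>\<close>, where the exponent \<open>e\<close> is \<open>2\<close> or \<open>1/3\<close> according
  to the symbol \<open>a 0\<close>. Such a map fixes the apex and descends to the cone
  (\<open>continuous_cone_map\<close>). After \<open>n\<close> steps the height is \<open>t\<close> to the power \<open>2 ^ p / 3 ^ q\<close>, where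
  \<open>p\<close> and \<open>q\<close> count the symbols read, so \<open>p + q = n\<close>.

  Two arithmetic facts about \<open>2 ^ p / 3 ^ q\<close> do the work. These numbers are dense in the
  positive reals (\<open>powers_2_div_powers_3_dense\<close>), and the shift lets one insert any numbers \<open>p\<close> and
  \<open>q\<close> of the two symbols between two prescribed words; hence any height strictly between \<open>0\<close> and
  \<open>1\<close> can be steered into any other interval of heights, and the map is transitive. On the other
  hand \<open>2 ^ p / 3 ^ q = 1\<close> only for \<open>p = q = 0\<close> (\<open>power2_eq_power3_iff\<close>), so a periodic point has
  height \<open>0\<close> or \<open>1\<close>; these points form a closed proper subset, and periodic points are not
  dense. For sensitivity, inserting a long run of one symbol pushes points of any open set towards
  the apex, while a run of the same length of the other symbol pushes points of the same set towards
  the rim \<open>t = 1\<close>; at that time one of the two is far from the image of any given point.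

  The two-sided shift is a bijection, and then so is the map on the cone, which gives the
  homeomorphism. The one-sided shift forgets a symbol; on the rim the heights do not distinguish the
  two preimages, so the map on the cone is not injective.\<close>

section \<open>The multiplicative semigroup of the numbers \<open>2 ^ p / 3 ^ q\<close>\<close>

lemma power2_eq_power3_iff: "(2::nat) ^ p = 3 ^ q \<longleftrightarrow> p = 0 \<and> q = 0"
proof
  assume eq: "(2::nat) ^ p = 3 ^ q"
  have "odd ((3::nat) ^ q)" by simp
  with eq have "p = 0" by (metis even_power even_numeral neq0_conv)
  with eq have "(3::nat) ^ q = 1" by simp
  then show "p = 0 \<and> q = 0" using \<open>p = 0\<close> by simp
qed simp

lemma ln2_div_ln3_irrational: "ln 2 / ln 3 \<notin> (\<rat> :: real set)"
proof
  assume "ln 2 / ln 3 \<in> (\<rat> :: real set)"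
  then obtain m n :: nat where "n \<noteq> 0" and mn: "\<bar>ln 2 / ln 3 :: real\<bar> = m / n"
    by (rule Rats_abs_nat_div_natE)
  then have "real n * ln 2 = real m * ln 3"
    by (simp add: field_simps)
  then have "ln ((2::real) ^ n) = ln (3 ^ m)"
    by (simp add: ln_realpow)
  then have "(2::real) ^ n = 3 ^ m" by simp
  then have "(2::nat) ^ n = 3 ^ m"
    by (metis of_nat_eq_iff of_nat_numeral of_nat_power)
  with \<open>n \<noteq> 0\<close> show False by (simp add: power2_eq_power3_iff)
qed

text \<open>Kronecker's theorem places the fractional part of \<open>k * \<theta>\<close> near that of any target, which only
  gives an integer \<open>q\<close>. Moving the target below \<open>0\<close> by a multiple of \<open>\<theta>\<close> beforehand makes \<open>q\<close> nonnegative.\<close>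

lemma irrational_multiples_minus_naturals_dense:
  fixes \<theta> x y :: real
  assumes irr: "\<theta> \<notin> \<rat>" and "\<theta> > 0" and "x < y"
  shows "\<exists>(p::nat) (q::nat). x < p * \<theta> - q \<and> p * \<theta> - q < y"
proof -
  define z where "z = (x + y) / 2"
  obtain p0 :: nat where p0: "z < real p0 * \<theta>"
    using reals_Archimedean3[OF \<open>\<theta> > 0\<close>] by blast
  define w where "w = z - p0 * \<theta>"
  have "w < 0" using p0 by (simp add: w_def)
  obtain k :: nat where k: "\<bar>frac (real k * \<theta>) - frac w\<bar> < (y - x) / 2"
    using Kronecker_approx_1_explicit[OF irr, of "frac w" "(y - x) / 2"] \<open>x < y\<close>
    by (metis diff_gt_0_iff_gt frac_ge_0 frac_lt_1 half_gt_zero less_imp_le)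
  define q where "q = nat (\<lfloor>k * \<theta>\<rfloor> - \<lfloor>w\<rfloor>)"
  have "\<lfloor>w\<rfloor> \<le> 0" "0 \<le> \<lfloor>k * \<theta>\<rfloor>" using \<open>w < 0\<close> \<open>\<theta> > 0\<close> by auto
  then have "\<lfloor>w\<rfloor> \<le> \<lfloor>k * \<theta>\<rfloor>" by (rule order_trans)
  then have q: "real q = real_of_int \<lfloor>k * \<theta>\<rfloor> - real_of_int \<lfloor>w\<rfloor>"
    unfolding q_def by (subst of_nat_nat) simp_all
  have "\<bar>k * \<theta> - q - w\<bar> < (y - x) / 2"
    using k by (simp add: q frac_def algebra_simps)
  then have "\<bar>real (p0 + k) * \<theta> - q - z\<bar> < (y - x) / 2"
    by (simp add: w_def algebra_simps)
  then have "x < real (p0 + k) * \<theta> - q \<and> real (p0 + k) * \<theta> - q < y"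
    unfolding z_def by (auto simp: abs_less_iff field_simps)
  then show ?thesis by blast
qed

text \<open>Taking logarithms to base \<open>3\<close> turns \<open>2 ^ p / 3 ^ q\<close> into \<open>p * \<theta> - q\<close> with \<open>\<theta> = ln 2 / ln 3\<close> irrational.\<close>

lemma powers_2_div_powers_3_dense:
  fixes x y :: real
  assumes "0 < x" "x < y"
  shows "\<exists>(p::nat) (q::nat). x < 2 ^ p / 3 ^ q \<and> 2 ^ p / 3 ^ q < y"
proof -
  have l3: "(0::real) < ln 3" by simp
  have "ln x / ln 3 < ln y / ln 3" using assms by (simp add: divide_strict_right_mono)
  then obtain p q :: nat where
    pq: "ln x / ln 3 < p * (ln 2 / ln 3) - q" "p * (ln 2 / ln 3) - q < ln y / ln 3"
    using irrational_multiples_minus_naturals_dense[OF ln2_div_ln3_irrational _ \<open>ln x / ln 3 < ln y / ln 3\<close>]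
    by auto
  have eq: "ln (2 ^ p / 3 ^ q :: real) = (p * (ln 2 / ln 3) - q) * ln 3"
    by (simp add: ln_div ln_realpow left_diff_distrib)
  have "ln x < ln (2 ^ p / 3 ^ q :: real)" "ln (2 ^ p / 3 ^ q :: real) < ln y"
    unfolding eq using pq l3 by (simp_all add: pos_divide_less_eq pos_less_divide_eq)
  then have "x < 2 ^ p / 3 ^ q" "2 ^ p / 3 ^ q < y"
    using assms by (simp_all add: ln_less_cancel_iff)
  then show ?thesis by blast
qed

section \<open>Exponent cocycles over a base system\<close>

text \<open>The power to which the height of a point over \<open>a\<close> is raised by \<open>n\<close> steps of the skew product.\<close>

definition exponent :: "('k \<Rightarrow> 'k) \<Rightarrow> ('k \<Rightarrow> real) \<Rightarrow> nat \<Rightarrow> 'k \<Rightarrow> real" where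
  "exponent \<tau> e n a = (\<Prod>j<n. e ((\<tau> ^^ j) a))"

lemma exponent_Suc: "exponent \<tau> e (Suc n) a = exponent \<tau> e n a * e ((\<tau> ^^ n) a)"
  by (simp add: exponent_def)

text \<open>The property of the base system that makes the skew product transitive and sensitive: orbits
  lead from any open set to any other one, and the factors \<open>2\<close> and \<open>1/3\<close> can be inserted on
  the way in arbitrary numbers. The constants \<open>\<kappa>\<close> and \<open>N\<close> account for the symbols
  that the two open sets prescribe. The travel time depends on \<open>p\<close> and \<open>q\<close> only through
  \<open>p + q\<close>, which allows two points with different exponents to be compared at the same time.\<close>

definition steerable :: "('k::topological_space \<Rightarrow> 'k) \<Rightarrow> ('k \<Rightarrow> real) \<Rightarrow> bool" where
  "steerable \<tau> e \<longleftrightarrow> continuous_on UNIV \<tau> \<and> continuous_on UNIV e \<and> range e \<subseteq> {2, 1/3} \<and>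
     (\<forall>U V. open U \<and> U \<noteq> {} \<and> open V \<and> V \<noteq> {} \<longrightarrow>
        (\<exists>\<kappa>>0. \<exists>N. \<forall>p q. \<exists>a\<in>U. (\<tau> ^^ (N + p + q)) a \<in> V \<and>
           exponent \<tau> e (N + p + q) a = \<kappa> * 2 ^ p / 3 ^ q))"

lemma steerable_exponents:
  assumes "steerable \<tau> e" "open U" "U \<noteq> {}" "open V" "V \<noteq> {}"
  shows "\<exists>\<kappa>>0. \<exists>N. \<forall>p q. \<exists>a\<in>U. (\<tau> ^^ (N + p + q)) a \<in> V \<and>
     exponent \<tau> e (N + p + q) a = \<kappa> * 2 ^ p / 3 ^ q"
  using assms unfolding steerable_def by simp

text \<open>The required orbit between \<open>U\<close> and \<open>V\<close> is the image of one between their preimages. This reduces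
  the one-sided shift to the two-sided one.\<close>

lemma steerable_factor:
  fixes \<phi> :: "'k::topological_space \<Rightarrow> 'l::topological_space"
  assumes st: "steerable \<tau> e" and cont: "continuous_on UNIV \<phi>" and "surj \<phi>"
    and \<tau>': "continuous_on UNIV \<tau>'" and e': "continuous_on UNIV e'"
    and \<phi>\<tau>: "\<And>a. \<phi> (\<tau> a) = \<tau>' (\<phi> a)" and \<phi>e: "\<And>a. e a = e' (\<phi> a)"
  shows "steerable \<tau>' e'"
proof -
  have iter: "\<phi> ((\<tau> ^^ n) a) = (\<tau>' ^^ n) (\<phi> a)" for n a
    by (induction n) (simp_all add: \<phi>\<tau>)
  have exp: "exponent \<tau> e n a = exponent \<tau>' e' n (\<phi> a)" for n a
    by (simp add: exponent_def \<phi>e iter)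
  have "range e' = range e"
  proof -
    have "range e' = e' ` range \<phi>" using \<open>surj \<phi>\<close> by simp
    then show ?thesis by (simp add: image_image \<phi>e)
  qed
  moreover have "\<exists>\<kappa>>0. \<exists>N. \<forall>p q. \<exists>b\<in>U. (\<tau>' ^^ (N + p + q)) b \<in> V \<and>
           exponent \<tau>' e' (N + p + q) b = \<kappa> * 2 ^ p / 3 ^ q"
    if "open U" "U \<noteq> {}" "open V" "V \<noteq> {}" for U V
  proof -
    have "open (\<phi> -` U)" "open (\<phi> -` V)"
      using cont that(1,3) by (auto simp: continuous_on_open_vimage[OF open_UNIV])
    moreover have "\<phi> -` U \<noteq> {}" "\<phi> -` V \<noteq> {}"
      using \<open>surj \<phi>\<close> that(2,4) by (simp_all add: surj_vimage_empty)
    ultimately have "\<exists>\<kappa>>0. \<exists>N. \<forall>p q. \<exists>a\<in>\<phi> -` U. (\<tau> ^^ (N + p + q)) a \<in> \<phi> -` V \<and>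
           exponent \<tau> e (N + p + q) a = \<kappa> * 2 ^ p / 3 ^ q"
      by (intro steerable_exponents[OF st])
    then obtain \<kappa> N where "\<kappa> > 0" and
      *: "\<forall>p q. \<exists>a\<in>\<phi> -` U. (\<tau> ^^ (N + p + q)) a \<in> \<phi> -` V \<and>
           exponent \<tau> e (N + p + q) a = \<kappa> * 2 ^ p / 3 ^ q"
      by (elim exE conjE) (rule that)
    have "\<exists>b\<in>U. (\<tau>' ^^ (N + p + q)) b \<in> V \<and>
           exponent \<tau>' e' (N + p + q) b = \<kappa> * 2 ^ p / 3 ^ q" for p q
      using *[rule_format, of p q] by (auto simp: iter exp)
    then show ?thesis using \<open>\<kappa> > 0\<close> by blast
  qed
  ultimately show ?thesis
    using st \<tau>' e' unfolding steerable_def by simp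
qed

lemma exponent_as_fraction:
  assumes "range e \<subseteq> {2, 1/3}"
  shows "\<exists>p q. p + q = n \<and> exponent \<tau> e n a = 2 ^ p / 3 ^ q"
proof (induction n)
  case 0
  show ?case by (simp add: exponent_def)
next
  case (Suc n)
  then obtain p q where pq: "p + q = n" "exponent \<tau> e n a = 2 ^ p / 3 ^ q" by blast
  have "e ((\<tau> ^^ n) a) = 2 \<or> e ((\<tau> ^^ n) a) = 1/3" using assms by blast
  then show ?case
  proof
    assume "e ((\<tau> ^^ n) a) = 2"
    with pq have "Suc p + q = Suc n \<and> exponent \<tau> e (Suc n) a = 2 ^ Suc p / 3 ^ q"
      by (simp add: exponent_Suc)
    then show ?thesis by blast
  next
    assume third: "e ((\<tau> ^^ n) a) = 1/3"
    from pq(1) have "p + Suc q = Suc n \<and> exponent \<tau> e (Suc n) a = 2 ^ p / 3 ^ Suc q"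
      unfolding exponent_Suc pq(2) third by simp
    then show ?thesis by blast
  qed
qed

lemma exponent_pos:
  assumes "range e \<subseteq> {2, 1/3}"
  shows "exponent \<tau> e n a > 0"
  using exponent_as_fraction[OF assms, of n \<tau> a] by auto

text \<open>This is what excludes periodic points away from the apex and the rim.\<close>

lemma exponent_eq_1_iff:
  assumes "range e \<subseteq> {2, 1/3}"
  shows "exponent \<tau> e n a = 1 \<longleftrightarrow> n = 0"
proof
  assume 1: "exponent \<tau> e n a = 1"
  obtain p q where pq: "p + q = n" "exponent \<tau> e n a = 2 ^ p / 3 ^ q"
    using exponent_as_fraction[OF assms] by blast
  with 1 have "(2::real) ^ p = 3 ^ q" by (simp add: field_simps)
  then have "(2::nat) ^ p = 3 ^ q"
    by (metis of_nat_eq_iff of_nat_numeral of_nat_power)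
  with pq show "n = 0" by (simp add: power2_eq_power3_iff)
qed (simp add: exponent_def)

section \<open>Shifts\<close>

lemma open_contains_cylinder:
  fixes U :: "(int \<Rightarrow> bool) set"
  assumes "open U" "x \<in> U"
  shows "\<exists>M::nat. \<forall>y. (\<forall>i. \<bar>i\<bar> < int M \<longrightarrow> y i = x i) \<longrightarrow> y \<in> U"
proof -
  have "openin (product_topology (\<lambda>i. euclidean) UNIV) U"
    using \<open>open U\<close> by (simp add: open_fun_def)
  from product_topology_open_contains_basis[OF this \<open>x \<in> U\<close>] obtain X where
    X: "x \<in> (\<Pi>\<^sub>E i\<in>UNIV. X i)" "finite {i. X i \<noteq> UNIV}" "(\<Pi>\<^sub>E i\<in>UNIV. X i) \<subseteq> U"
    by auto
  define M where "M = Suc (\<Sum>i\<in>{i. X i \<noteq> UNIV}. nat \<bar>i\<bar>)"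
  have "y \<in> U" if y: "\<And>i. \<bar>i\<bar> < int M \<Longrightarrow> y i = x i" for y
  proof -
    have "y i \<in> X i" for i
    proof (cases "X i = UNIV")
      case False
      then have "nat \<bar>i\<bar> \<le> (\<Sum>i\<in>{i. X i \<noteq> UNIV}. nat \<bar>i\<bar>)"
        using X(2) by (intro member_le_sum) auto
      then have "\<bar>i\<bar> < int M" unfolding M_def by linarith
      then show ?thesis using y X(1) by (auto simp: PiE_iff)
    qed simp
    then show ?thesis using X(3) by auto
  qed
  then show ?thesis by blast
qed

lemma iterate_two_sided_shift: "((\<lambda>a i. a (i + 1)) ^^ n) a = (\<lambda>i::int. a (i + int n))"
  by (induction n) (auto simp: algebra_simps)

lemma prod_lessThan_add:
  fixes f :: "nat \<Rightarrow> 'a::comm_monoid_mult"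
  shows "prod f {..<m + n} = prod f {..<m} * (\<Prod>i<n. f (m + i))"
  by (induction n) (simp_all add: mult_ac)

lemma continuous_on_coordinate_choice:
  "continuous_on UNIV (\<lambda>a :: 'i \<Rightarrow> bool. if a i then x else y :: real)"
proof -
  have "continuous_on UNIV ((\<lambda>b::bool. if b then x else y) \<circ> (\<lambda>a :: 'i \<Rightarrow> bool. a i))"
    by (rule continuous_on_compose) simp_all
  then show ?thesis by (simp add: o_def)
qed

lemma continuous_on_reindex:
  "continuous_on UNIV (\<lambda>(a :: 'i \<Rightarrow> 'b::topological_space) j. a (r j))"
  by (intro continuous_on_coordinatewise_then_product) simp

text \<open>On a window of radius \<open>M\<close>, the open sets are determined by words \<open>v\<close> and \<open>w\<close>. Put \<open>p\<close> symbols
  \<open>True\<close> and \<open>q\<close> symbols \<open>False\<close> after the window of \<open>v\<close>, and then the window of \<open>w\<close>. The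
  orbit starts at the centre of the first window and ends at the centre of the second one, so the
  right half of \<open>v\<close> and the left half of \<open>w\<close> are read in addition and contribute \<open>\<kappa>\<close>.\<close>

lemma steerable_two_sided_shift:
  "steerable (\<lambda>(a :: int \<Rightarrow> bool) i. a (i + 1)) (\<lambda>a. if a 0 then 2 else 1/3)"
    (is "steerable ?\<sigma> ?e")
proof -
  have exp: "exponent ?\<sigma> ?e n a = (\<Prod>j<n. if a (int j) then 2 else 1/3)" for n a
    by (simp add: exponent_def iterate_two_sided_shift)
  have "\<exists>\<kappa>>0. \<exists>N. \<forall>p q. \<exists>a\<in>U. (?\<sigma> ^^ (N + p + q)) a \<in> V \<and>
           exponent ?\<sigma> ?e (N + p + q) a = \<kappa> * 2 ^ p / 3 ^ q"
    if UV: "open U" "U \<noteq> {}" "open V" "V \<noteq> {}" for U V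
  proof -
    obtain v w where "v \<in> U" "w \<in> V" using UV by blast
    obtain M1 :: nat where M1: "\<And>y. (\<And>i. \<bar>i\<bar> < int M1 \<Longrightarrow> y i = v i) \<Longrightarrow> y \<in> U"
      using open_contains_cylinder[OF UV(1) \<open>v \<in> U\<close>] by blast
    obtain M2 :: nat where M2: "\<And>y. (\<And>i. \<bar>i\<bar> < int M2 \<Longrightarrow> y i = w i) \<Longrightarrow> y \<in> V"
      using open_contains_cylinder[OF UV(3) \<open>w \<in> V\<close>] by blast
    define M where "M = max M1 M2"
    define \<kappa> :: real where
      "\<kappa> = (\<Prod>j<M. if v (int j) then 2 else 1/3) *
           (\<Prod>j<M. if w (int j - int M) then 2 else 1/3)"
    have "\<kappa> > 0" unfolding \<kappa>_def by (intro mult_pos_pos prod_pos) auto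
    have "\<exists>a\<in>U. (?\<sigma> ^^ (2 * M + p + q)) a \<in> V \<and>
           exponent ?\<sigma> ?e (2 * M + p + q) a = \<kappa> * 2 ^ p / 3 ^ q" for p q
    proof -
      define a where "a = (\<lambda>i. if i < int M then v i else if i < int (M + p) then True
          else if i < int (M + p + q) then False else w (i - int (2 * M + p + q)))"
      have a_left: "a i = v i" if "i < int M" for i
        using that by (simp add: a_def)
      have a_right: "a (i + int (2 * M + p + q)) = w i" if "- int M \<le> i" for i
        using that by (simp add: a_def)
      have "a \<in> U" by (rule M1) (simp add: a_left M_def)
      moreover have "(?\<sigma> ^^ (2 * M + p + q)) a \<in> V"
        unfolding iterate_two_sided_shift by (rule M2) (rule a_right, simp add: M_def)
      moreover have "exponent ?\<sigma> ?e (2 * M + p + q) a = \<kappa> * 2 ^ p / 3 ^ q"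
      proof -
        have "exponent ?\<sigma> ?e (((M + p) + q) + M) a =
          (\<Prod>j<M. if a (int j) then 2 else 1/3) * (\<Prod>j<p. if a (int (M + j)) then 2 else 1/3) *
          (\<Prod>j<q. if a (int (M + p + j)) then 2 else 1/3) *
          (\<Prod>j<M. if a (int (M + p + q + j)) then 2 else 1/3)"
          unfolding exp prod_lessThan_add ..
        also have "(\<Prod>j<M. if a (int j) then 2 else 1/3 :: real) =
            (\<Prod>j<M. if v (int j) then 2 else 1/3)"
          by (simp add: a_left)
        also have "(\<Prod>j<p. if a (int (M + j)) then 2 else 1/3 :: real) = (\<Prod>j<p. 2)"
          by (simp add: a_def)
        also have "(\<Prod>j<q. if a (int (M + p + j)) then 2 else 1/3 :: real) = (\<Prod>j<q. 1/3)"
          by (simp add: a_def)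
        also have "(\<Prod>j<M. if a (int (M + p + q + j)) then 2 else 1/3 :: real) =
            (\<Prod>j<M. if w (int j - int M) then 2 else 1/3)"
        proof (rule prod.cong)
          fix j assume "j \<in> {..<M}"
          show "(if a (int (M + p + q + j)) then 2 else 1/3 :: real) =
              (if w (int j - int M) then 2 else 1/3)"
            using a_right[of "int j - int M"] by (simp add: algebra_simps)
        qed simp
        finally have "exponent ?\<sigma> ?e (M + p + q + M) a = \<kappa> * 2 ^ p / 3 ^ q"
          by (simp add: \<kappa>_def field_simps)
        moreover have "2 * M + p + q = M + p + q + M" by simp
        ultimately show ?thesis by (simp only:)
      qed
      ultimately show ?thesis by blast
    qed
    then show ?thesis using \<open>\<kappa> > 0\<close> by blast
  qed
  moreover have "continuous_on UNIV ?\<sigma>" by (rule continuous_on_reindex)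
  moreover have "continuous_on UNIV ?e" by (rule continuous_on_coordinate_choice)
  ultimately show ?thesis unfolding steerable_def by auto
qed

lemma steerable_one_sided_shift:
  "steerable (\<lambda>(a :: nat \<Rightarrow> bool) i. a (i + 1)) (\<lambda>a. if a 0 then 2 else 1/3)"
proof (rule steerable_factor[OF steerable_two_sided_shift])
  show "continuous_on UNIV (\<lambda>(a :: int \<Rightarrow> bool) i. a (int i))"
    by (rule continuous_on_reindex)
  show "surj (\<lambda>(a :: int \<Rightarrow> bool) i. a (int i))"
  proof (rule surjI)
    show "(\<lambda>i. (b \<circ> nat) (int i)) = b" for b :: "nat \<Rightarrow> bool" by simp
  qed
  show "continuous_on UNIV (\<lambda>(a :: nat \<Rightarrow> bool) i. a (i + 1))"
    by (rule continuous_on_reindex)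
  show "continuous_on UNIV (\<lambda>a :: nat \<Rightarrow> bool. if a 0 then 2 else 1/3 :: real)"
    by (rule continuous_on_coordinate_choice)
qed (simp_all add: add.commute)

section \<open>Skew products on a cone\<close>

text \<open>A continuous map from a compact space to a Hausdorff space is closed, hence a quotient map onto
  its image.\<close>

lemma continuous_on_quotient_lift:
  fixes Q :: "'b::topological_space \<Rightarrow> 'c::t2_space"
    and F :: "'c \<Rightarrow> 'd::topological_space"
  assumes "compact S" and Q: "continuous_on S Q" and FQ: "continuous_on S (F \<circ> Q)"
  shows "continuous_on (Q ` S) F"
  unfolding continuous_closedin_preimage_eq
proof (intro allI impI)
  fix T :: "'d set" assume "closed T"
  then have "closedin (top_of_set S) (S \<inter> (F \<circ> Q) -` T)"
    using FQ unfolding continuous_closedin_preimage_eq by (elim allE impE)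
  then have "compact (S \<inter> (F \<circ> Q) -` T)"
    by (rule closedin_compact[OF \<open>compact S\<close>])
  then have "compact (Q ` (S \<inter> (F \<circ> Q) -` T))"
    by (rule compact_continuous_image[OF continuous_on_subset[OF Q], rotated]) simp
  moreover have "Q ` (S \<inter> (F \<circ> Q) -` T) = Q ` S \<inter> F -` T" by auto
  ultimately have "closed (Q ` S \<inter> F -` T)"
    by (simp add: compact_imp_closed)
  then show "closedin (top_of_set (Q ` S)) (Q ` S \<inter> F -` T)"
    by (simp add: closed_subset)
qed

lemma disjoint_compact_separated:
  fixes A B :: "'a::metric_space set"
  assumes "compact A" "compact B" "A \<inter> B = {}"
  shows "\<exists>d>0. \<forall>x\<in>A. \<forall>y\<in>B. d \<le> dist x y"
proof (cases "A \<times> B = {}")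
  case True
  then have "\<forall>x\<in>A. \<forall>y\<in>B. 1 \<le> dist x y" by auto
  then show ?thesis using zero_less_one by blast
next
  case False
  have "continuous_on (A \<times> B) (\<lambda>z. dist (fst z) (snd z))"
    by (intro continuous_intros)
  then obtain z where z: "z \<in> A \<times> B" "\<And>w. w \<in> A \<times> B \<Longrightarrow> dist (fst z) (snd z) \<le> dist (fst w) (snd w)"
    using continuous_attains_inf[OF compact_Times[OF assms(1,2)] False] by blast
  then have "dist (fst z) (snd z) > 0" using assms(3) by auto
  moreover have "\<forall>x\<in>A. \<forall>y\<in>B. dist (fst z) (snd z) \<le> dist x y"
    using z(2)[OF SigmaI] by simp
  ultimately show ?thesis by blast
qed

text \<open>The map \<open>Q\<close> presents \<open>C\<close> as the cone over the base space; \<open>t = 0\<close> is the apex.\<close>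

locale symbolic_cone =
  fixes Q :: "'k::topological_space \<times> real \<Rightarrow> 'a::metric_space" and C :: "'a set"
    and \<tau> :: "'k \<Rightarrow> 'k" and e :: "'k \<Rightarrow> real"
  assumes compact_base: "compact (UNIV :: 'k set)"
    and continuous_Q: "continuous_on (UNIV \<times> {0..1}) Q"
    and image_Q: "Q ` (UNIV \<times> {0..1}) = C"
    and Q_eq_iff: "\<And>a b s t. s \<in> {0..1} \<Longrightarrow> t \<in> {0..1} \<Longrightarrow>
           Q (a, s) = Q (b, t) \<longleftrightarrow> s = t \<and> (a = b \<or> s = 0)"
    and steerable: "steerable \<tau> e"
begin

text \<open>The skew product, read off from an arbitrary preimage. The choice matters only at the apex,
  where all preimages give the apex again, because \<open>0 powr e a = 0\<close>.\<close>

definition cone_map :: "'a \<Rightarrow> 'a" where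
  "cone_map y = (case inv_into (UNIV \<times> {0..1}) Q y of (a, t) \<Rightarrow> Q (\<tau> a, t powr e a))"

lemma e_range: "range e \<subseteq> {2, 1/3}"
  using steerable by (simp add: steerable_def)

lemma continuous_base: "continuous_on UNIV \<tau>" and continuous_e: "continuous_on UNIV e"
  using steerable by (simp_all add: steerable_def)

lemma e_pos: "e a > 0"
proof -
  have "e a \<in> {2, 1/3}" using e_range by blast
  then show ?thesis by auto
qed

lemma powr_unit: "s \<ge> 0 \<Longrightarrow> t \<in> {0..1} \<Longrightarrow> t powr s \<in> {0..1::real}"
  by (simp add: powr_le1)

lemma cone_point: "y \<in> C \<Longrightarrow> \<exists>a t. t \<in> {0..1} \<and> y = Q (a, t)"
  using image_Q by blast

lemma Q_in_C: "t \<in> {0..1} \<Longrightarrow> Q (a, t) \<in> C"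
  using image_Q by auto

lemma cone_map_Q:
  assumes t: "t \<in> {0..1}"
  shows "cone_map (Q (a, t)) = Q (\<tau> a, t powr e a)"
proof -
  obtain b s where bs: "inv_into (UNIV \<times> {0..1}) Q (Q (a, t)) = (b, s)" by fastforce
  have mem: "Q (a, t) \<in> Q ` (UNIV \<times> {0..1})" using t by blast
  have "s \<in> {0..1}" "Q (b, s) = Q (a, t)"
    using inv_into_into[OF mem] f_inv_into_f[OF mem] by (simp_all add: bs)
  then have *: "s = t \<and> (b = a \<or> s = 0)" using t by (metis Q_eq_iff)
  have "Q (\<tau> b, s powr e b) = Q (\<tau> a, t powr e a)"
  proof (cases "t = 0")
    case True
    with * show ?thesis by (simp add: Q_eq_iff)
  qed (use * in auto)
  then show ?thesis by (simp add: cone_map_def bs)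
qed

lemma iterate_cone_map_Q:
  assumes t: "t \<in> {0..1}"
  shows "(cone_map ^^ n) (Q (a, t)) = Q ((\<tau> ^^ n) a, t powr exponent \<tau> e n a)"
proof (induction n)
  case 0
  show ?case using t by (cases "t = 0") (simp_all add: exponent_def Q_eq_iff)
next
  case (Suc n)
  have "t powr exponent \<tau> e n a \<in> {0..1}"
    by (rule powr_unit[OF less_imp_le t]) (rule exponent_pos[OF e_range])
  then show ?case
    by (simp add: Suc cone_map_Q powr_powr exponent_Suc)
qed

lemma compact_parameters: "compact (UNIV \<times> {0..1} :: ('k \<times> real) set)"
  by (intro compact_Times compact_base) simp

lemma compact_C: "compact C"
  using compact_continuous_image[OF continuous_Q compact_parameters] by (simp add: image_Q)

lemma continuous_cone_map: "continuous_on C cone_map"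
proof -
  have cont: "continuous_on (UNIV \<times> {0..1}) (\<lambda>x. (\<tau> (fst x), snd x powr e (fst x)))"
  proof (intro continuous_on_Pair continuous_on_powr')
    show "continuous_on (UNIV \<times> {0..1}) (\<lambda>x. \<tau> (fst x))"
      by (rule continuous_on_compose2[OF continuous_base]) (auto intro: continuous_on_fst)
    show "continuous_on (UNIV \<times> {0..1}) (\<lambda>x. e (fst x))"
      by (rule continuous_on_compose2[OF continuous_e]) (auto intro: continuous_on_fst)
    show "continuous_on (UNIV \<times> {0..1}) (\<lambda>x. snd x :: real)"
      by (intro continuous_on_snd continuous_on_id)
  qed (auto simp: e_pos)
  have "continuous_on (UNIV \<times> {0..1}) (\<lambda>x. Q (\<tau> (fst x), snd x powr e (fst x)))"
    by (rule continuous_on_compose2[OF continuous_Q cont])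
      (auto simp: powr_le1 e_pos less_imp_le)
  then have "continuous_on (UNIV \<times> {0..1}) (cone_map \<circ> Q)"
    by (rule continuous_on_eq) (auto simp: cone_map_Q)
  from continuous_on_quotient_lift[OF compact_parameters continuous_Q this]
  show ?thesis by (simp add: image_Q)
qed

lemma cone_map_into: "cone_map ` C \<subseteq> C"
proof
  fix y assume "y \<in> cone_map ` C"
  then obtain a t where "t \<in> {0..1}" "y = cone_map (Q (a, t))"
    using cone_point by blast
  then show "y \<in> C"
    using Q_in_C[OF powr_unit[OF less_imp_le[OF e_pos]]] by (simp add: cone_map_Q)
qed

lemma dynamical_system_cone_map: "dynamical_system C cone_map"
  by (simp add: dynamical_system_def compact_C continuous_cone_map cone_map_into)

text \<open>The box can be kept off the apex and the rim because the heights strictly between \<open>0\<close> and \<open>1\<close>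
  are dense in \<open>[0,1]\<close>.\<close>

lemma open_contains_box:
  assumes "openin (top_of_set C) U" "U \<noteq> {}"
  shows "\<exists>A \<alpha> \<beta>. open A \<and> A \<noteq> {} \<and> 0 < \<alpha> \<and> \<alpha> < \<beta> \<and> \<beta> < 1 \<and> Q ` (A \<times> {\<alpha><..<\<beta>}) \<subseteq> U"
proof -
  obtain T where T: "open T" "U = C \<inter> T"
    using assms(1) by (auto simp: openin_open)
  obtain W where W: "open W" "W \<inter> (UNIV \<times> {0..1}) = Q -` T \<inter> (UNIV \<times> {0..1})"
    using continuous_Q T(1) unfolding continuous_on_open_invariant by blast
  have WU: "Q x \<in> U" if "x \<in> W" "snd x \<in> {0..1}" for x
  proof -
    have "x \<in> W \<inter> (UNIV \<times> {0..1})" using that by (simp add: mem_Times_iff)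
    then have "x \<in> Q -` T" unfolding W(2) by simp
    then show ?thesis using T(2) Q_in_C[of "snd x" "fst x"] that(2) by simp
  qed
  obtain a t where at: "t \<in> {0..1}" "Q (a, t) \<in> U"
    using assms(2) cone_point T(2) by blast
  then have "(a, t) \<in> W" using W(2) T(2) by blast
  then obtain A B where AB: "open A" "open B" "a \<in> A" "t \<in> B" "A \<times> B \<subseteq> W"
    using W(1) by (metis mem_Sigma_iff open_prod_elim)
  have "t \<in> closure {0<..<1}" using at(1) by simp
  then have "B \<inter> {0<..<1} \<noteq> {}"
    using AB(2,4) by (metis IntI empty_iff open_Int_closure_eq_empty)
  then obtain u where "u \<in> B \<inter> {0<..<1}" by blast
  moreover have "open (B \<inter> {0<..<1})" using AB(2) by auto
  ultimately obtain r where "r > 0" "ball u r \<subseteq> B \<inter> {0<..<1}"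
    using open_contains_ball by metis
  then have r: "{u - r<..<u + r} \<subseteq> B \<inter> {0<..<1}" by (simp add: ball_eq_greaterThanLessThan)
  have "u \<in> {u - r<..<u + r}" "u + r / 2 \<in> {u - r<..<u + r}" using \<open>r > 0\<close> by auto
  with r have "u \<in> {0<..<1}" "u + r / 2 \<in> {0<..<1}" by blast+
  then have u: "0 < u" "u + r / 2 < 1" by simp_all
  have sub: "{u<..<u + r / 2} \<subseteq> B \<inter> {0<..<1}"
    using r \<open>r > 0\<close> by (auto intro!: subsetD[OF r])
  have "Q ` (A \<times> {u<..<u + r / 2}) \<subseteq> U"
  proof clarify
    fix b s assume "b \<in> A" "s \<in> {u<..<u + r / 2}"
    with sub AB(5) show "Q (b, s) \<in> U" by (intro WU) auto
  qed
  then show ?thesis using AB(1,3) u \<open>r > 0\<close> by (intro exI[of _ A] exI[of _ u] exI[of _ "u + r / 2"]) auto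
qed

text \<open>Inside boxes in the two open sets, steering takes care of the base coordinate, and the density
  of the numbers \<open>2 ^ p / 3 ^ q\<close> takes care of the height.\<close>

lemma transitive_cone_map: "transitive_system C cone_map"
  unfolding transitive_system_def
proof (intro allI impI, elim conjE)
  fix U V assume U: "openin (top_of_set C) U" "U \<noteq> {}" and V: "openin (top_of_set C) V" "V \<noteq> {}"
  obtain A \<alpha> \<beta> where A: "open A" "A \<noteq> {}" "0 < \<alpha>" "\<alpha> < \<beta>" "\<beta> < 1" "Q ` (A \<times> {\<alpha><..<\<beta>}) \<subseteq> U"
    using open_contains_box[OF U] by blast
  obtain B \<gamma> \<delta> where B: "open B" "B \<noteq> {}" "0 < \<gamma>" "\<gamma> < \<delta>" "\<delta> < 1" "Q ` (B \<times> {\<gamma><..<\<delta>}) \<subseteq> V"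
    using open_contains_box[OF V] by blast
  obtain \<kappa> N where "\<kappa> > 0" and N: "\<forall>p q. \<exists>a\<in>A. (\<tau> ^^ (N + p + q)) a \<in> B \<and>
     exponent \<tau> e (N + p + q) a = \<kappa> * 2 ^ p / 3 ^ q"
    using steerable_exponents[OF steerable A(1,2) B(1,2)] by (elim exE conjE) (rule that)
  define t where "t = (\<alpha> + \<beta>) / 2"
  have t: "t \<in> {\<alpha><..<\<beta>}" "0 < t" "t < 1" using A by (auto simp: t_def)
  \<comment> \<open>On the scale of \<open>- ln\<close>, the exponent \<open>\<kappa> * r\<close> takes the height \<open>t\<close> to \<open>r * L\<close>.\<close>
  define L where "L = - (\<kappa> * ln t)"
  have "L > 0" using t \<open>\<kappa> > 0\<close> by (simp add: L_def mult_pos_neg)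
  have "0 < - ln \<delta> / L" "- ln \<delta> / L < - ln \<gamma> / L"
    using B \<open>L > 0\<close> by (simp_all add: divide_neg_pos divide_strict_right_mono)
  then obtain p q :: nat where pq: "- ln \<delta> / L < 2 ^ p / 3 ^ q" "2 ^ p / 3 ^ q < - ln \<gamma> / L"
    using powers_2_div_powers_3_dense by blast
  obtain a where a: "a \<in> A" "(\<tau> ^^ (N + p + q)) a \<in> B"
     "exponent \<tau> e (N + p + q) a = \<kappa> * 2 ^ p / 3 ^ q"
    using N[rule_format, of p q] by blast
  have ln: "ln (t powr (\<kappa> * 2 ^ p / 3 ^ q)) = - (2 ^ p / 3 ^ q * L)"
    using t by (simp add: ln_powr L_def)
  have "ln \<gamma> < ln (t powr (\<kappa> * 2 ^ p / 3 ^ q))" "ln (t powr (\<kappa> * 2 ^ p / 3 ^ q)) < ln \<delta>"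
    unfolding ln using pq \<open>L > 0\<close> by (simp_all only: pos_divide_less_eq pos_less_divide_eq)
  moreover have "t powr (\<kappa> * 2 ^ p / 3 ^ q) > 0" "\<delta> > 0" using B t by simp_all
  ultimately have "t powr (\<kappa> * 2 ^ p / 3 ^ q) \<in> {\<gamma><..<\<delta>}"
    using \<open>0 < \<gamma>\<close> by (simp only: ln_less_cancel_iff greaterThanLessThan_iff)
  then have "(cone_map ^^ (N + p + q)) (Q (a, t)) \<in> V"
    using B(6) a t by (auto simp: iterate_cone_map_Q)
  moreover have "Q (a, t) \<in> U" using A(6) a(1) t(1) by blast
  ultimately show "\<exists>n. (cone_map ^^ n) ` U \<inter> V \<noteq> {}" by blast
qed

text \<open>With \<open>m\<close> extra factors \<open>2\<close> the exponent tends to infinity and the height to \<open>0\<close>; with \<open>m\<close>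
  extra factors \<open>1/3\<close> the exponent tends to \<open>0\<close> and the height to \<open>1\<close>. Both take the same time.\<close>

lemma open_reaches_apex_and_rim:
  assumes "openin (top_of_set C) U" "U \<noteq> {}"
  shows "\<exists>n>0. (\<exists>y\<in>U. (cone_map ^^ n) y \<in> Q ` (UNIV \<times> {0..1/3})) \<and>
     (\<exists>y\<in>U. (cone_map ^^ n) y \<in> Q ` (UNIV \<times> {2/3..1}))"
proof -
  obtain A \<alpha> \<beta> where A: "open A" "A \<noteq> {}" "0 < \<alpha>" "\<alpha> < \<beta>" "\<beta> < 1" "Q ` (A \<times> {\<alpha><..<\<beta>}) \<subseteq> U"
    using open_contains_box[OF assms] by blast
  obtain \<kappa> N where "\<kappa> > 0" and N: "\<forall>p q. \<exists>a\<in>A. (\<tau> ^^ (N + p + q)) a \<in> UNIV \<and>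
     exponent \<tau> e (N + p + q) a = \<kappa> * 2 ^ p / 3 ^ q"
    using steerable_exponents[OF steerable A(1,2) open_UNIV UNIV_not_empty]
    by (elim exE conjE) (rule that)
  define t where "t = (\<alpha> + \<beta>) / 2"
  have t: "t \<in> {\<alpha><..<\<beta>}" "0 < t" "t < 1" using A by (auto simp: t_def)
  have "filterlim (\<lambda>m. \<kappa> * 2 ^ m) at_top sequentially"
    by (rule filterlim_tendsto_pos_mult_at_top[OF tendsto_const \<open>\<kappa> > 0\<close>])
      (intro filterlim_at_infinity_imp_filterlim_at_top filterlim_realpow_sequentially_gt1, simp_all)
  then have "filterlim (\<lambda>m. ln t * (\<kappa> * 2 ^ m)) at_bot sequentially"
    using t by (intro filterlim_tendsto_neg_mult_at_bot[OF tendsto_const]) simp_all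
  then have "(\<lambda>m. exp (ln t * (\<kappa> * 2 ^ m))) \<longlonglongrightarrow> 0"
    by (rule filterlim_compose[OF exp_at_bot])
  then have "(\<lambda>m. t powr (\<kappa> * 2 ^ m)) \<longlonglongrightarrow> 0"
    using t by (simp add: powr_def mult_ac)
  have "(\<lambda>m. t powr (\<kappa> / 3 ^ m)) \<longlonglongrightarrow> t powr 0"
    using t by (intro tendsto_intros LIMSEQ_divide_realpow_zero) simp_all
  then have "\<forall>\<^sub>F m in sequentially. t powr (\<kappa> / 3 ^ m) > 2/3"
    by (rule order_tendstoD) (use t in simp)
  moreover have "\<forall>\<^sub>F m in sequentially. t powr (\<kappa> * 2 ^ m) < 1/3"
    by (rule order_tendstoD[OF \<open>(\<lambda>m. t powr (\<kappa> * 2 ^ m)) \<longlonglongrightarrow> 0\<close>]) simp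
  ultimately have "\<forall>\<^sub>F m in sequentially. t powr (\<kappa> * 2 ^ m) < 1/3 \<and> t powr (\<kappa> / 3 ^ m) > 2/3 \<and> m > 0"
    by (intro eventually_conj eventually_gt_at_top)
  then obtain m where m: "t powr (\<kappa> * 2 ^ m) < 1/3" "t powr (\<kappa> / 3 ^ m) > 2/3" "m > 0"
    using eventually_happens'[OF sequentially_bot] by blast
  have "\<exists>a\<in>A. exponent \<tau> e (N + m) a = \<kappa> * 2 ^ m"
    using N[rule_format, of m 0] by simp
  then obtain a where a: "a \<in> A" "exponent \<tau> e (N + m) a = \<kappa> * 2 ^ m" ..
  have "\<exists>b\<in>A. exponent \<tau> e (N + m) b = \<kappa> / 3 ^ m"
    using N[rule_format, of 0 m] by simp
  then obtain b where b: "b \<in> A" "exponent \<tau> e (N + m) b = \<kappa> / 3 ^ m" ..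
  have "Q (a, t) \<in> U" "Q (b, t) \<in> U" using A(6) a(1) b(1) t(1) by blast+
  moreover have "t powr (\<kappa> / 3 ^ m) \<le> 1" using t \<open>\<kappa> > 0\<close> by (simp add: powr_le1)
  then have "(cone_map ^^ (N + m)) (Q (a, t)) \<in> Q ` (UNIV \<times> {0..1/3})"
    "(cone_map ^^ (N + m)) (Q (b, t)) \<in> Q ` (UNIV \<times> {2/3..1})"
    using t m(1,2) by (simp_all add: iterate_cone_map_Q a b)
  moreover have "N + m > 0" using m(3) by simp
  ultimately show ?thesis by blast
qed

text \<open>The parts of the cone with height at most \<open>1/3\<close> and at least \<open>2/3\<close> are compact and disjoint,
  so they have a positive distance \<open>d\<close>. The image of any ball meets both of them at some common
  time, and then no point can be within \<open>d / 3\<close> of both images.\<close>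

lemma sensitive_cone_map: "sensitive_system C cone_map"
proof -
  define A where "A = Q ` (UNIV \<times> {0..1/3})"
  define B where "B = Q ` (UNIV \<times> {2/3..1})"
  have "compact A" unfolding A_def
    by (intro compact_continuous_image continuous_on_subset[OF continuous_Q] compact_Times compact_base) auto
  have "compact B" unfolding B_def
    by (intro compact_continuous_image continuous_on_subset[OF continuous_Q] compact_Times compact_base) auto
  have "A \<inter> B = {}" unfolding A_def B_def by (auto simp: Q_eq_iff)
  then obtain d where d: "d > 0" "\<And>x y. x \<in> A \<Longrightarrow> y \<in> B \<Longrightarrow> d \<le> dist x y"
    using disjoint_compact_separated[OF \<open>compact A\<close> \<open>compact B\<close>] by blast
  have "\<exists>y\<in>C. dist x y < \<delta> \<and> (\<exists>n::nat. n > 0 \<and> dist ((cone_map ^^ n) x) ((cone_map ^^ n) y) > d / 3)"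
    if "x \<in> C" "\<delta> > 0" for x \<delta>
  proof -
    have U: "openin (top_of_set C) (C \<inter> ball x \<delta>)" by (rule openin_open_Int) simp
    moreover have "x \<in> C \<inter> ball x \<delta>" using that by simp
    ultimately obtain n y z where n: "n > 0" and
      y: "y \<in> C \<inter> ball x \<delta>" "(cone_map ^^ n) y \<in> A" and
      z: "z \<in> C \<inter> ball x \<delta>" "(cone_map ^^ n) z \<in> B"
      using open_reaches_apex_and_rim[of "C \<inter> ball x \<delta>"] unfolding A_def B_def by blast
    let ?x = "(cone_map ^^ n) x" and ?y = "(cone_map ^^ n) y" and ?z = "(cone_map ^^ n) z"
    have "d \<le> dist ?y ?z" using d(2) y(2) z(2) by blast
    also have "\<dots> \<le> dist ?x ?y + dist ?x ?z" by (rule dist_triangle3)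
    finally have "dist ?x ?y > d / 3 \<or> dist ?x ?z > d / 3" using d(1) by linarith
    then show ?thesis using n y(1) z(1) by auto
  qed
  then show ?thesis unfolding sensitive_system_def using d(1) by (intro exI[of _ "d / 3"]) auto
qed

text \<open>A height strictly between \<open>0\<close> and \<open>1\<close> is fixed only by the exponent \<open>1\<close>, which never occurs
  after a positive number of steps.\<close>

lemma periodic_points_cone_map: "periodic_points C cone_map \<subseteq> Q ` (UNIV \<times> {0, 1})"
proof
  fix y assume "y \<in> periodic_points C cone_map"
  then obtain n a t where n: "n > 0" "(cone_map ^^ n) y = y" and y: "t \<in> {0..1}" "y = Q (a, t)"
    unfolding periodic_points_def using cone_point by blast
  let ?E = "exponent \<tau> e n a"
  have "?E > 0" by (rule exponent_pos[OF e_range])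
  have "Q ((\<tau> ^^ n) a, t powr ?E) = Q (a, t)"
    using n(2) y by (simp add: iterate_cone_map_Q)
  then have fixed: "t powr ?E = t"
    using y(1) powr_unit[OF less_imp_le[OF \<open>?E > 0\<close>] y(1)] by (simp add: Q_eq_iff)
  have "t = 0 \<or> t = 1"
  proof (rule ccontr)
    assume "\<not> (t = 0 \<or> t = 1)"
    with y(1) have "0 < t" "t < 1" by auto
    then have "?E * ln t = 1 * ln t" using arg_cong[OF fixed, of ln] by (simp add: ln_powr)
    then have "?E = 1" using \<open>0 < t\<close> \<open>t < 1\<close> by simp
    with n(1) show False by (simp add: exponent_eq_1_iff[OF e_range])
  qed
  then show "y \<in> Q ` (UNIV \<times> {0, 1})" using y(2) by blast
qed

lemma not_devaney_chaotic_cone_map: "\<not> devaney_chaotic C cone_map"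
proof
  assume "devaney_chaotic C cone_map"
  then have "C \<subseteq> closure (periodic_points C cone_map)" by (simp add: devaney_chaotic_def)
  also have "\<dots> \<subseteq> closure (Q ` (UNIV \<times> {0, 1}))"
    by (rule closure_mono[OF periodic_points_cone_map])
  also have "compact (Q ` (UNIV \<times> {0, 1}))"
    by (intro compact_continuous_image continuous_on_subset[OF continuous_Q] compact_Times compact_base) auto
  then have "closure (Q ` (UNIV \<times> {0, 1})) = Q ` (UNIV \<times> {0, 1})"
    by (simp add: compact_imp_closed)
  finally have "Q (undefined, 1/2) \<in> Q ` (UNIV \<times> {0, 1})" using Q_in_C[of "1/2"] by auto
  then show False by (auto simp: Q_eq_iff)
qed

lemma robinson_chaotic_cone_map: "robinson_chaotic C cone_map"
  by (simp add: robinson_chaotic_def transitive_cone_map sensitive_cone_map)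

text \<open>On the rim every exponent acts trivially, so the cone map there is a copy of the base map.\<close>

lemma inj_base_if_inj_cone_map:
  assumes "inj_on cone_map C"
  shows "inj \<tau>"
proof (rule injI)
  fix a b assume "\<tau> a = \<tau> b"
  then have "cone_map (Q (a, 1)) = cone_map (Q (b, 1))" by (simp add: cone_map_Q)
  then have "Q (a, 1) = Q (b, 1)"
    using assms by (auto dest!: inj_onD intro: Q_in_C)
  then show "a = b" by (simp add: Q_eq_iff)
qed

text \<open>On each segment the map is a power function with positive exponent, hence a bijection of \<open>[0,1]\<close>
  fixing \<open>0\<close>; a bijective base map permutes the segments. Compactness supplies the continuity of the inverse.\<close>

lemma homeomorphism_cone_map:
  assumes "bij \<tau>"
  shows "\<exists>g. homeomorphism C C cone_map g"
proof (rule homeomorphism_compact[OF compact_C continuous_cone_map])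
  show "inj_on cone_map C"
  proof (rule inj_onI)
    fix x y assume "x \<in> C" "y \<in> C" and eq: "cone_map x = cone_map y"
    then obtain a s b t where x: "s \<in> {0..1}" "x = Q (a, s)" and y: "t \<in> {0..1}" "y = Q (b, t)"
      using cone_point by metis
    have unit: "s powr e a \<in> {0..1}" "t powr e b \<in> {0..1}"
      using x y by (auto simp: powr_le1 e_pos less_imp_le)
    have "Q (\<tau> a, s powr e a) = Q (\<tau> b, t powr e b)"
      using eq x y by (simp add: cone_map_Q)
    then have *: "s powr e a = t powr e b" "\<tau> a = \<tau> b \<or> s powr e a = 0"
      using Q_eq_iff[OF unit] by auto
    show "x = y"
    proof (cases "s = 0")
      case True
      with *(1) have "t = 0" by auto
      with True show ?thesis using x y by (simp add: Q_eq_iff)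
    next
      case False
      with * assms have "a = b" by (auto simp: bij_def inj_eq)
      with *(1) have "(s powr e a) powr (1 / e a) = (t powr e a) powr (1 / e a)" by simp
      then have "s = t" using x(1) y(1) e_pos[of a] by (simp add: powr_powr)
      with \<open>a = b\<close> show ?thesis using x y by simp
    qed
  qed
  show "cone_map ` C = C"
  proof (rule antisym[OF cone_map_into])
    show "C \<subseteq> cone_map ` C"
    proof
      fix y assume "y \<in> C"
      then obtain b t where y: "t \<in> {0..1}" "y = Q (b, t)" using cone_point by blast
      obtain a where "b = \<tau> a" using assms by (metis bij_pointE)
      have unit: "t powr (1 / e a) \<in> {0..1}"
        using y(1) e_pos[of a] by (simp add: powr_le1)
      have "cone_map (Q (a, t powr (1 / e a))) = y"
        using y e_pos[of a] unit by (simp add: cone_map_Q powr_powr \<open>b = \<tau> a\<close>)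
      then show "y \<in> cone_map ` C" using Q_in_C[OF unit] by blast
    qed
  qed
qed

end

section \<open>Cantor fans as cones over sequence spaces\<close>

lemma compact_bool_functions: "compact (UNIV :: ('i \<Rightarrow> bool) set)"
proof -
  have "compact_space (euclidean :: bool topology)"
    by (simp add: compact_space_def compactin_euclidean_iff finite_imp_compact)
  then have "compact_space (product_topology (\<lambda>i::'i. euclidean :: bool topology) UNIV)"
    by (simp add: compact_space_product_topology)
  then show ?thesis
    by (simp add: euclidean_product_topology compact_space_def compactin_euclidean_iff)
qed

definition ternary :: "(nat \<Rightarrow> bool) \<Rightarrow> real" where
  "ternary a = (\<Sum>n. (if a n then 2 else 0) / 3 ^ Suc n)"

lemma ternary_majorant_sums: "(\<lambda>n. 2 / 3 ^ Suc n :: real) sums 1"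
proof -
  have "(\<lambda>n. 2 / 3 * (1/3) ^ n :: real) sums (2 / 3 * (1 / (1 - 1/3)))"
    by (intro sums_mult geometric_sums) simp
  then show ?thesis by (simp add: power_one_over)
qed

lemma summable_ternary: "summable (\<lambda>n. (if a n then 2 else 0) / 3 ^ Suc n :: real)"
  by (rule summable_comparison_test'[OF sums_summable[OF ternary_majorant_sums], of 0]) auto

lemma ternary_bounds: "0 \<le> ternary a" "ternary a \<le> 1"
proof -
  show "0 \<le> ternary a"
    unfolding ternary_def by (intro suminf_nonneg summable_ternary) simp
  have "ternary a \<le> (\<Sum>n. 2 / 3 ^ Suc n)"
    unfolding ternary_def
    by (intro suminf_le summable_ternary sums_summable[OF ternary_majorant_sums]) simp
  then show "ternary a \<le> 1" by (simp only: sums_unique[OF ternary_majorant_sums, symmetric])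
qed

text \<open>The self-similarity of the Cantor set: the first digit of an expansion decides between the thirds
  \<open>[0, 1/3]\<close> and \<open>[2/3, 1]\<close>, and the remaining digits are an expansion of the rescaled
  point. Reading off one digit after the other gives uniqueness of the expansion.\<close>

lemma ternary_split: "3 * ternary a = (if a 0 then 2 else 0) + ternary (\<lambda>n. a (Suc n))"
proof -
  have "ternary (\<lambda>n. a (Suc n)) = (\<Sum>n. 3 * ((if a (Suc n) then 2 else 0) / 3 ^ Suc (Suc n)))"
    unfolding ternary_def by (rule suminf_cong) simp
  also have "\<dots> = 3 * (\<Sum>n. (if a (Suc n) then 2 else 0) / 3 ^ Suc (Suc n))"
    using summable_ternary[of a] by (intro suminf_mult) (subst summable_Suc_iff)
  also have "\<dots> = 3 * (ternary a - (if a 0 then 2 else 0) / 3 ^ Suc 0)"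
    unfolding ternary_def by (subst suminf_split_head[OF summable_ternary]) simp
  finally show ?thesis by simp
qed

lemma inj_ternary: "inj ternary"
proof (rule injI)
  have head: "a 0 = b 0 \<and> ternary (\<lambda>n. a (Suc n)) = ternary (\<lambda>n. b (Suc n))"
    if "ternary a = ternary b" for a b
    using that ternary_split[of a] ternary_split[of b]
      ternary_bounds[of "\<lambda>n. a (Suc n)"] ternary_bounds[of "\<lambda>n. b (Suc n)"]
    by (auto split: if_splits)
  have "a n = b n" if "ternary a = ternary b" for a b n
    using that
  proof (induction n arbitrary: a b)
    case 0
    then show ?case using head by blast
  next
    case (Suc n)
    then show ?case using head[OF Suc.prems] Suc.IH[of "\<lambda>n. a (Suc n)" "\<lambda>n. b (Suc n)"] by blast
  qed
  then show "a = b" if "ternary a = ternary b" for a b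
    using that by blast
qed

lemma continuous_on_ternary: "continuous_on UNIV ternary"
proof -
  let ?f = "\<lambda>n (a :: nat \<Rightarrow> bool). (if a n then 2 else 0) / 3 ^ Suc n :: real"
  have "uniform_limit UNIV (\<lambda>n a. \<Sum>i<n. ?f i a) (\<lambda>a. \<Sum>i. ?f i a) sequentially"
    by (rule Weierstrass_m_test[OF _ sums_summable[OF ternary_majorant_sums]]) simp
  moreover have "continuous_on UNIV (\<lambda>a. \<Sum>i<n. ?f i a)" for n
    by (intro continuous_intros continuous_on_coordinate_choice) simp
  ultimately have "continuous_on UNIV (\<lambda>a. \<Sum>i. ?f i a)"
    by (intro uniform_limit_theorem[where F = sequentially]) simp_all
  then show ?thesis by (simp add: ternary_def[abs_def])
qed

lemma cantor_set_coding:
  assumes "cantor_set K"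
  shows "\<exists>c :: (nat \<Rightarrow> bool) \<Rightarrow> 'a::metric_space. continuous_on UNIV c \<and> range c = K \<and> inj c"
proof -
  obtain f g where fg: "homeomorphism K ternary_cantor_set f g"
    using assms unfolding cantor_set_def homeomorphic_def by blast
  have range: "range ternary = ternary_cantor_set"
    by (simp add: ternary_cantor_set_def ternary_def[abs_def])
  let ?c = "g \<circ> ternary"
  have "continuous_on UNIV ?c"
    using homeomorphism_cont2[OF fg] by (intro continuous_on_compose continuous_on_ternary) (simp add: range)
  moreover have "range ?c = K"
    using homeomorphism_image2[OF fg] by (simp only: image_comp[symmetric] range)
  moreover have "inj ?c"
    by (rule comp_inj_on[OF inj_ternary]) (metis fg homeomorphism_apply2 inj_on_inverseI range)
  ultimately show ?thesis by blast
qed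

lemma planar_fan_alt: "planar_fan K = (\<lambda>(c, t). (t * c, - t)) ` (K \<times> {0..1})"
  unfolding planar_fan_def closed_segment_def by force

text \<open>The homeomorphism comes from a planar fan, which the second coordinate \<open>- t\<close> divides into
  levels. On the level \<open>t > 0\<close> the first coordinate \<open>t * c\<close> determines \<open>c\<close>.\<close>

lemma cantor_fan_parametrization:
  fixes C :: "'a::metric_space set"
  assumes "cantor_fan C"
  shows "\<exists>Q :: (nat \<Rightarrow> bool) \<times> real \<Rightarrow> 'a.
    continuous_on (UNIV \<times> {0..1}) Q \<and> Q ` (UNIV \<times> {0..1}) = C \<and>
    (\<forall>a b. \<forall>s\<in>{0..1}. \<forall>t\<in>{0..1}. Q (a, s) = Q (b, t) \<longleftrightarrow> s = t \<and> (a = b \<or> s = 0))"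
proof -
  obtain K where "cantor_set K" "C homeomorphic planar_fan K"
    using assms unfolding cantor_fan_def by blast
  then obtain f g where fg: "homeomorphism C (planar_fan K) f g"
    unfolding homeomorphic_def by blast
  obtain c :: "(nat \<Rightarrow> bool) \<Rightarrow> real" where c: "continuous_on UNIV c" "range c = K" "inj c"
    using cantor_set_coding[OF \<open>cantor_set K\<close>] by blast
  define P where "P = (\<lambda>x :: (nat \<Rightarrow> bool) \<times> real. (snd x * c (fst x), - snd x))"
  have P_image: "P ` (UNIV \<times> {0..1}) = planar_fan K"
    unfolding P_def planar_fan_alt c(2)[symmetric] by force
  have "continuous_on (UNIV \<times> {0..1}) (\<lambda>x :: (nat \<Rightarrow> bool) \<times> real. c (fst x))"
    by (rule continuous_on_compose2[OF c(1)]) (auto intro: continuous_on_fst)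
  then have P_cont: "continuous_on (UNIV \<times> {0..1}) P"
    unfolding P_def by (intro continuous_intros)
  have P_eq: "P (a, s) = P (b, t) \<longleftrightarrow> s = t \<and> (a = b \<or> s = 0)" for a b s t
    using c(3) by (auto simp: P_def inj_eq)
  show ?thesis
  proof (intro exI[of _ "g \<circ> P"] conjI allI ballI)
    show "continuous_on (UNIV \<times> {0..1}) (g \<circ> P)"
      using homeomorphism_cont2[OF fg] by (intro continuous_on_compose P_cont) (simp add: P_image)
    show "(g \<circ> P) ` (UNIV \<times> {0..1}) = C"
      unfolding image_comp[symmetric] P_image by (rule homeomorphism_image2[OF fg])
    have g: "inj_on g (planar_fan K)"
      by (metis fg homeomorphism_apply2 inj_on_inverseI)
    show "(g \<circ> P) (a, s) = (g \<circ> P) (b, t) \<longleftrightarrow> s = t \<and> (a = b \<or> s = 0)"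
      if "s \<in> {0..1}" "t \<in> {0..1}" for a b s t
    proof -
      have "P (a, s) \<in> planar_fan K" "P (b, t) \<in> planar_fan K"
        using that P_image by blast+
      then show ?thesis by (simp add: inj_on_eq_iff[OF g] P_eq)
    qed
  qed
qed

lemma bij_two_sided_shift: "bij (\<lambda>(a :: int \<Rightarrow> bool) i. a (i + 1))"
  by (rule bij_betw_byWitness[where f' = "\<lambda>a i. a (i - 1)"]) auto

lemma not_inj_one_sided_shift: "\<not> inj (\<lambda>(a :: nat \<Rightarrow> bool) i. a (i + 1))"
proof
  assume "inj (\<lambda>(a :: nat \<Rightarrow> bool) i. a (i + 1))"
  then have "(\<lambda>i::nat. True) = (\<lambda>i. i \<noteq> 0)" by (rule injD) simp
  from fun_cong[OF this, of 0] show False by simp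
qed

theorem theorem4p19:
  fixes C :: "'a::metric_space set"
  assumes "cantor_fan C"
  shows "(\<exists>f. dynamical_system C f \<and> \<not> (\<exists>g. homeomorphism C C f g) \<and>
              robinson_chaotic C f \<and> \<not> devaney_chaotic C f) \<and>
         (\<exists>h. dynamical_system C h \<and> (\<exists>g. homeomorphism C C h g) \<and>
              robinson_chaotic C h \<and> \<not> devaney_chaotic C h)"
proof -
  obtain Q :: "(nat \<Rightarrow> bool) \<times> real \<Rightarrow> 'a" where Q:
    "continuous_on (UNIV \<times> {0..1}) Q" "Q ` (UNIV \<times> {0..1}) = C"
    "\<forall>a b. \<forall>s\<in>{0..1}. \<forall>t\<in>{0..1}. Q (a, s) = Q (b, t) \<longleftrightarrow> s = t \<and> (a = b \<or> s = 0)"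
    using cantor_fan_parametrization[OF assms] by (elim exE conjE) (rule that)
  interpret one: symbolic_cone Q C "\<lambda>a i. a (i + 1)" "\<lambda>a. if a 0 then 2 else 1/3"
  proof
    show "steerable (\<lambda>(a :: nat \<Rightarrow> bool) i. a (i + 1)) (\<lambda>a. if a 0 then 2 else 1/3)"
      by (rule steerable_one_sided_shift)
    show "compact (UNIV :: (nat \<Rightarrow> bool) set)" by (rule compact_bool_functions)
    show "Q (a, s) = Q (b, t) \<longleftrightarrow> s = t \<and> (a = b \<or> s = 0)"
      if "s \<in> {0..1}" "t \<in> {0..1}" for a b s t
      using Q(3)[rule_format, OF that] .
  qed (rule Q)+

  \<comment> \<open>Enumerating the integers turns two-sided sequences into one-sided ones, so the same fan is
    also a cone over the two-sided sequences.\<close>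
  define r :: "(int \<Rightarrow> bool) \<Rightarrow> nat \<Rightarrow> bool" where "r = (\<lambda>a n. a (int_decode n))"
  have "bij r"
    unfolding r_def by (rule bij_betw_byWitness[where f' = "\<lambda>b i. b (int_encode i)"]) auto
  have r_cont: "continuous_on UNIV r" unfolding r_def by (rule continuous_on_reindex)
  define R where "R = (\<lambda>x :: (int \<Rightarrow> bool) \<times> real. (r (fst x), snd x))"
  have R_image: "R ` (UNIV \<times> {0..1}) = UNIV \<times> {0..1}"
  proof -
    have "R = map_prod r id" by (auto simp: R_def)
    then show ?thesis using \<open>bij r\<close> by (simp add: map_prod_surj_on bij_def)
  qed
  have "continuous_on (UNIV \<times> {0..1}) (\<lambda>x :: (int \<Rightarrow> bool) \<times> real. r (fst x))"
    by (rule continuous_on_compose2[OF r_cont]) (auto intro: continuous_on_fst)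
  then have R_cont: "continuous_on (UNIV \<times> {0..1}) R"
    unfolding R_def by (intro continuous_on_Pair continuous_on_snd continuous_on_id)
  interpret two: symbolic_cone "Q \<circ> R" C "\<lambda>a i. a (i + 1)" "\<lambda>a. if a 0 then 2 else 1/3"
  proof
    show "compact (UNIV :: (int \<Rightarrow> bool) set)" by (rule compact_bool_functions)
    show "continuous_on (UNIV \<times> {0..1}) (Q \<circ> R)"
      using Q(1) by (intro continuous_on_compose R_cont) (simp add: R_image)
    show "(Q \<circ> R) ` (UNIV \<times> {0..1}) = C"
      by (simp only: image_comp[symmetric] R_image Q(2))
    show "(Q \<circ> R) (a, s) = (Q \<circ> R) (b, t) \<longleftrightarrow> s = t \<and> (a = b \<or> s = 0)"
      if "s \<in> {0..1}" "t \<in> {0..1}" for a b s t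
      using Q(3)[rule_format, OF that] \<open>bij r\<close> by (simp add: R_def bij_def inj_eq)
    show "steerable (\<lambda>(a :: int \<Rightarrow> bool) i. a (i + 1)) (\<lambda>a. if a 0 then 2 else 1/3)"
      by (rule steerable_two_sided_shift)
  qed

  have not_homeomorphism: "\<not> (\<exists>g. homeomorphism C C one.cone_map g)"
  proof
    assume "\<exists>g. homeomorphism C C one.cone_map g"
    then obtain g where "homeomorphism C C one.cone_map g" ..
    then have "inj_on one.cone_map C"
      by (intro inj_on_inverseI[of C g]) (rule homeomorphism_apply1)
    then have "inj (\<lambda>(a :: nat \<Rightarrow> bool) i. a (i + 1))"
      by (rule one.inj_base_if_inj_cone_map)
    with not_inj_one_sided_shift show False ..
  qed
  show ?thesis
  proof (rule conjI)
    show "\<exists>f. dynamical_system C f \<and> \<not> (\<exists>g. homeomorphism C C f g) \<and>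
        robinson_chaotic C f \<and> \<not> devaney_chaotic C f"
      by (rule exI[of _ one.cone_map]) (intro conjI one.dynamical_system_cone_map
          not_homeomorphism one.robinson_chaotic_cone_map one.not_devaney_chaotic_cone_map)
    show "\<exists>h. dynamical_system C h \<and> (\<exists>g. homeomorphism C C h g) \<and>
        robinson_chaotic C h \<and> \<not> devaney_chaotic C h"
      by (rule exI[of _ two.cone_map]) (intro conjI two.dynamical_system_cone_map
          two.homeomorphism_cone_map[OF bij_two_sided_shift]
          two.robinson_chaotic_cone_map two.not_devaney_chaotic_cone_map)
  qed
qed

end
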